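(* Let $\alpha\in(0,1)$, let $Z_{1:n+1}=\{(X_i,Y_i)\}_{i=1}^{n+1}$ with $(X_i,Y_i)\in\mathbb{R}^d\times\mathbb{R}$ be exchangeable, and let $\mathcal{M}_1,\dots,\mathcal{M}_K$ be Bayesian models with likelihoods $p_{\theta_k}(y\mid x)$, priors $\pi_k(\theta_k)$ and prior model probabilities $p(\mathcal{M}_k)$. Let $$\sigma_i^{CBMA}=\sum_{k=1}^K p(\mathcal{M}_k\mid Z_{1:n+1})\,p_{\mathcal{M}_k}(Y_i\mid X_i,Z_{1:n+1}),\qquad i=1,\dots,n+1,$$ and assume that this conformity measure is invariant to permutations of $Z_{1:n+1}$. For $y\in\mathcal{Y}$ let $$r_{CBMA}(y)=\frac{1}{n+1}\sum_{i=1}^{n+1}\mathbf{1}\left(\sigma_i^{CBMA}\le\sigma_{n+1}^{CBMA}\right),$$ where the scores are computed with $Y_{n+1}$ set equal to $y$, and let $$C_\alpha^{CBMA}(X_{n+1})=\{y\in\mathcal{Y}: r_{CBMA}(y)>\alpha\}.$$ Then $$\mathbf{P}\left(Y_{n+1}\in C_\alpha^{CBMA}(X_{n+1})\right)\ge 1-\alpha,$$ where $\mathbf{P}$ is over $Z_{1:n+1}$. Moreover, if the conformity measures $\{\sigma_i^{CBMA}\}_{i=1}^{n+1}$ are almost surely distinct, then $$\mathbf{P}\left(Y_{n+1}\in C_\alpha^{CBMA}(X_{n+1})\right)\le 1-\alpha+\frac{1}{n+1}.$$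
   Context: $\mathcal{Y}\subseteq\mathbb{R}$ is the response space. For each model $\mathcal{M}_k$: - The parameter posterior is $\pi_k(\theta_k\mid Z_{1:n+1})\propto\pi_k(\theta_k)\prod_{i=1}^{n+1}p_{\theta_k}(Y_i\mid X_i)$. - The posterior predictive density is $p_{\mathcal{M}_k}(y\mid x,Z_{1:n+1})=\int p_{\theta_k}(y\mid x)\,\pi_k(\theta_k\mid Z_{1:n+1})\,d\theta_k$. - The marginal likelihood is $m(Z_{1:n+1}\mid\mathcal{M}_k)=\int\prod_{i=1}^{n+1}p_{\theta_k}(Y_i\mid X_i)\,\pi_k(\theta_k)\,d\theta_k$. - The posterior model probability is $p(\mathcal{M}_k\mid Z_{1:n+1})=\dfrac{m(Z_{1:n+1}\mid\mathcal{M}_k)\,p(\mathcal{M}_k)}{\sum_{l=1}^K m(Z_{1:n+1}\mid\mathcal{M}_l)\,p(\mathcal{M}_l)}$. All these quantities are understood to be well defined (the normalizing integrals are finite and positive). Invariance to permutations means that the score assigned to a given data point $Z_i=(X_i,Y_i)$ is unchanged when the data set $Z_{1:n+1}$ is permuted. In the distinctness condition the scores are those computed from the actual data $Z_{1:n+1}$. *)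

theory Defs
  imports "HOL-Probability.Probability" "HOL-Combinatorics.Permutations"
begin

text \<open>
  A data set \<open>Z\<^sub>1, \<dots>, Z\<^sub>N\<close> is a function \<open>z :: nat \<Rightarrow> 'x \<times> real\<close>, of which only the values at
  \<open>1, \<dots>, N\<close> are relevant. The response space is the measure space \<open>\<nu>\<close>: its carrier \<open>space \<nu>\<close> is the
  set of possible responses, and the likelihoods are densities with respect to \<open>\<nu>\<close> (such as Lebesgue
  or counting measure).

  The measure \<open>params m\<close> is the reference measure \<open>d\<theta>\<close> on the parameter space of the model \<open>m\<close>.
  Models under comparison share the type \<open>'t\<close> but not the parameter space; spaces of different
  dimensions are obtained, for instance, as \<open>Pi\<^sub>M {..<d} (\<lambda>_. lborel)\<close> with \<open>'t = nat \<Rightarrow> real\<close>.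
\<close>

record ('t, 'x) model =
  params :: "'t measure"
  lik :: "'t \<Rightarrow> 'x \<Rightarrow> real \<Rightarrow> real"
  prior :: "'t \<Rightarrow> real"

definition bayesian_model :: "real measure \<Rightarrow> ('t, 'x::topological_space) model \<Rightarrow> bool" where
  "bayesian_model \<nu> m \<longleftrightarrow>
     sigma_finite_measure (params m) \<and>
     prior m \<in> borel_measurable (params m) \<and>
     (\<forall>\<theta>\<in>space (params m). 0 \<le> prior m \<theta>) \<and>
     (\<integral>\<^sup>+ \<theta>. ennreal (prior m \<theta>) \<partial>params m) = 1 \<and>
     (\<lambda>(\<theta>, x, y). lik m \<theta> x y) \<in> borel_measurable (params m \<Otimes>\<^sub>M (borel \<Otimes>\<^sub>M \<nu>)) \<and>
     (\<forall>\<theta>\<in>space (params m). \<forall>x. \<forall>y\<in>space \<nu>. 0 \<le> lik m \<theta> x y) \<and>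
     (\<forall>\<theta>\<in>space (params m). \<forall>x. (\<integral>\<^sup>+ y. ennreal (lik m \<theta> x y) \<partial>\<nu>) = 1)"

definition data_lik :: "nat \<Rightarrow> ('t, 'x) model \<Rightarrow> (nat \<Rightarrow> 'x \<times> real) \<Rightarrow> 't \<Rightarrow> real" where
  "data_lik N m z \<theta> = (\<Prod>i\<in>{1..N}. lik m \<theta> (fst (z i)) (snd (z i)))"

definition marginal_lik :: "nat \<Rightarrow> ('t, 'x) model \<Rightarrow> (nat \<Rightarrow> 'x \<times> real) \<Rightarrow> real" where
  "marginal_lik N m z = (\<integral>\<theta>. data_lik N m z \<theta> * prior m \<theta> \<partial>params m)"

definition posterior :: "nat \<Rightarrow> ('t, 'x) model \<Rightarrow> (nat \<Rightarrow> 'x \<times> real) \<Rightarrow> 't \<Rightarrow> real" where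
  "posterior N m z \<theta> =
     prior m \<theta> * data_lik N m z \<theta> / (\<integral>\<theta>'. prior m \<theta>' * data_lik N m z \<theta>' \<partial>params m)"

definition predictive ::
  "nat \<Rightarrow> ('t, 'x) model \<Rightarrow> (nat \<Rightarrow> 'x \<times> real) \<Rightarrow> 'x \<Rightarrow> real \<Rightarrow> real" where
  "predictive N m z x y = (\<integral>\<theta>. lik m \<theta> x y * posterior N m z \<theta> \<partial>params m)"

text \<open>The models are \<open>\<M> 1, \<dots>, \<M> K\<close>, with prior probabilities \<open>w 1, \<dots>, w K\<close>.\<close>

definition model_posterior ::
  "nat \<Rightarrow> nat \<Rightarrow> (nat \<Rightarrow> ('t, 'x) model) \<Rightarrow> (nat \<Rightarrow> real) \<Rightarrow> (nat \<Rightarrow> 'x \<times> real) \<Rightarrow> nat \<Rightarrow> real" where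
  "model_posterior N K \<M> w z k =
     marginal_lik N (\<M> k) z * w k / (\<Sum>l\<in>{1..K}. marginal_lik N (\<M> l) z * w l)"

text \<open>
  Bochner integrals of non-integrable functions and quotients by zero are \<open>0\<close> by convention. The
  following predicate says that no such value enters the scores of the data set \<open>z\<close>.
\<close>

definition cbma_well_defined ::
  "nat \<Rightarrow> nat \<Rightarrow> (nat \<Rightarrow> ('t, 'x) model) \<Rightarrow> (nat \<Rightarrow> 'x \<times> real) \<Rightarrow> bool" where
  "cbma_well_defined N K \<M> z \<longleftrightarrow>
     (\<forall>k\<in>{1..K}.
        integrable (params (\<M> k)) (\<lambda>\<theta>. data_lik N (\<M> k) z \<theta> * prior (\<M> k) \<theta>) \<and>
        0 < marginal_lik N (\<M> k) z \<and>
        (\<forall>i\<in>{1..N}. integrable (params (\<M> k))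
           (\<lambda>\<theta>. lik (\<M> k) \<theta> (fst (z i)) (snd (z i)) * posterior N (\<M> k) z \<theta>)))"

text \<open>The score of a point \<open>p\<close> given the data set \<open>z\<close>; the \<open>i\<close>-th conformity score takes \<open>p = z i\<close>.\<close>

definition cbma_measure ::
  "nat \<Rightarrow> nat \<Rightarrow> (nat \<Rightarrow> ('t, 'x) model) \<Rightarrow> (nat \<Rightarrow> real) \<Rightarrow> (nat \<Rightarrow> 'x \<times> real) \<Rightarrow> 'x \<times> real \<Rightarrow> real" where
  "cbma_measure N K \<M> w z p =
     (\<Sum>k\<in>{1..K}. model_posterior N K \<M> w z k * predictive N (\<M> k) z (fst p) (snd p))"

definition cbma_score ::
  "nat \<Rightarrow> nat \<Rightarrow> (nat \<Rightarrow> ('t, 'x) model) \<Rightarrow> (nat \<Rightarrow> real) \<Rightarrow> (nat \<Rightarrow> 'x \<times> real) \<Rightarrow> nat \<Rightarrow> real" where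
  "cbma_score N K \<M> w z i = cbma_measure N K \<M> w z (z i)"

definition permutation_invariant ::
  "nat \<Rightarrow> real set \<Rightarrow> ((nat \<Rightarrow> 'x \<times> real) \<Rightarrow> 'x \<times> real \<Rightarrow> real) \<Rightarrow> bool" where
  "permutation_invariant N Ys s \<longleftrightarrow>
     (\<forall>z. (\<forall>i\<in>{1..N}. snd (z i) \<in> Ys) \<longrightarrow>
        (\<forall>\<pi>. \<pi> permutes {1..N} \<longrightarrow> (\<forall>i\<in>{1..N}. s (z \<circ> \<pi>) (z i) = s z (z i))))"

definition cbma_rank ::
  "nat \<Rightarrow> nat \<Rightarrow> (nat \<Rightarrow> ('t, 'x) model) \<Rightarrow> (nat \<Rightarrow> real) \<Rightarrow> (nat \<Rightarrow> 'x \<times> real) \<Rightarrow> 'x \<Rightarrow> real \<Rightarrow> real" where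
  "cbma_rank n K \<M> w z x y =
     (let z' = z(n + 1 := (x, y)) in
      (1 / real (n + 1)) *
      (\<Sum>i\<in>{1..n + 1}. of_bool (cbma_score (n + 1) K \<M> w z' i \<le> cbma_score (n + 1) K \<M> w z' (n + 1))))"

definition cbma_set ::
  "real set \<Rightarrow> real \<Rightarrow> nat \<Rightarrow> nat \<Rightarrow> (nat \<Rightarrow> ('t, 'x) model) \<Rightarrow> (nat \<Rightarrow> real) \<Rightarrow> (nat \<Rightarrow> 'x \<times> real) \<Rightarrow>
    'x \<Rightarrow> real set" where
  "cbma_set Ys \<alpha> n K \<M> w z x = {y \<in> Ys. cbma_rank n K \<M> w z x y > \<alpha>}"

definition exchangeable :: "'w measure \<Rightarrow> nat \<Rightarrow> (nat \<Rightarrow> 'w \<Rightarrow> 'b::topological_space) \<Rightarrow> bool" where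
  "exchangeable P N Z \<longleftrightarrow>
     (\<forall>i\<in>{1..N}. Z i \<in> measurable P borel) \<and>
     (\<forall>\<pi>. \<pi> permutes {1..N} \<longrightarrow>
        distr P (Pi\<^sub>M {1..N} (\<lambda>_. borel)) (\<lambda>\<omega>. \<lambda>i\<in>{1..N}. Z (\<pi> i) \<omega>) =
        distr P (Pi\<^sub>M {1..N} (\<lambda>_. borel)) (\<lambda>\<omega>. \<lambda>i\<in>{1..N}. Z i \<omega>))"

end

theory Submission
  imports Defs
begin

text \<open>
  Permuting the data permutes the scores, so by exchangeability every index \<open>j\<close> has the same
  probability of having a rank above \<open>\<alpha>\<close>. The coverage probability is therefore the expected
  fraction of indices whose rank exceeds \<open>\<alpha>\<close>, and this fraction is at least \<open>1 - \<alpha>\<close> for every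
  data set, and at most \<open>1 - \<alpha> + 1 / (n + 1)\<close> when the scores are distinct.
\<close>

section \<open>Counting by rank, first pointwise, then in expectation\<close>

definition rank_frac :: "nat \<Rightarrow> (nat \<Rightarrow> real) \<Rightarrow> nat \<Rightarrow> real" where
  "rank_frac N s j = real (card {i\<in>{1..N}. s i \<le> s j}) / real N"

text \<open>Take an index \<open>j\<close> of maximal score among those of rank at most \<alpha>.
  The rank of \<open>j\<close> counts all of them, since ties are counted by the non-strict
  comparison, and it is itself at most \<alpha>.\<close>

lemma card_rank_frac_le:
  assumes "0 < N" "0 \<le> \<alpha>"
  shows "real (card {j\<in>{1..N}. rank_frac N s j \<le> \<alpha>}) \<le> \<alpha> * real N"
proof -
  define J where "J = {j\<in>{1..N}. rank_frac N s j \<le> \<alpha>}"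
  have fin: "finite J" by (simp add: J_def)
  show ?thesis
  proof (cases "J = {}")
    case True
    then show ?thesis using assms unfolding J_def [symmetric] by simp
  next
    case False
    have "Max (s ` J) \<in> s ` J" using fin False by (intro Max_in) auto
    then obtain j where j: "j \<in> J" "s j = Max (s ` J)" by force
    have "J \<subseteq> {i\<in>{1..N}. s i \<le> s j}"
      using fin j by (auto simp: J_def)
    then have "card J \<le> card {i\<in>{1..N}. s i \<le> s j}"
      by (intro card_mono) auto
    moreover have "real (card {i\<in>{1..N}. s i \<le> s j}) \<le> \<alpha> * real N"
      using j(1) assms by (simp add: J_def rank_frac_def field_simps)
    ultimately show ?thesis unfolding J_def [symmetric] by simp
  qed
qed

lemma card_rank_frac_gt_ge:
  assumes "0 < N" "0 \<le> \<alpha>"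
  shows "(1 - \<alpha>) * real N \<le> real (card {j\<in>{1..N}. \<alpha> < rank_frac N s j})"
proof -
  have "card {1..N} = card {j\<in>{1..N}. rank_frac N s j \<le> \<alpha>} + card {j\<in>{1..N}. \<alpha> < rank_frac N s j}"
    by (subst card_Un_disjoint [symmetric]) (auto intro!: arg_cong [where f = card] simp del: card_atLeastAtMost)
  with card_rank_frac_le [OF assms, of s] show ?thesis
    by (simp add: algebra_simps)
qed

text \<open>Take an index \<open>j\<close> of minimal score among those in \<open>U\<close>, of rank
  above \<alpha>. With distinct scores its rank counts no other member of \<open>U\<close>, so more
  than \<alpha> * \<open>N\<close> indices fit into \<open>j\<close> and the complement of
  \<open>U\<close>.\<close>

lemma card_rank_frac_gt_le:
  assumes "0 < N" "\<alpha> \<le> 1" "inj_on s {1..N}"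
  shows "real (card {j\<in>{1..N}. \<alpha> < rank_frac N s j}) \<le> (1 - \<alpha>) * real N + 1"
proof -
  define U where "U = {j\<in>{1..N}. \<alpha> < rank_frac N s j}"
  have fin: "finite U" and sub: "U \<subseteq> {1..N}" by (auto simp: U_def)
  show ?thesis
  proof (cases "U = {}")
    case True
    then show ?thesis using assms unfolding U_def [symmetric] by simp
  next
    case False
    have "Min (s ` U) \<in> s ` U" using fin False by (intro Min_in) auto
    then obtain j where j: "j \<in> U" "s j = Min (s ` U)" by force
    have "i = j" if "i \<in> U" "s i \<le> s j" for i
    proof -
      have "s j \<le> s i" using fin j(2) that(1) by simp
      then show ?thesis
        using that j(1) sub assms(3) by (auto dest: inj_onD)
    qed
    \<comment> \<open>The inserted \<open>j\<close> is the source of the extra \<open>1 / N\<close>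
      in the upper coverage bound.\<close>
    then have "{i\<in>{1..N}. s i \<le> s j} \<subseteq> insert j ({1..N} - U)" by auto
    then have "card {i\<in>{1..N}. s i \<le> s j} \<le> card (insert j ({1..N} - U))"
      by (intro card_mono) auto
    also have "\<dots> \<le> Suc (card ({1..N} - U))" by (rule card_insert_le_m1) auto
    also have "card ({1..N} - U) = N - card U"
      using fin sub by (subst card_Diff_subset) auto
    \<comment> \<open>Since \<open>U\<close> has at most \<open>N\<close> elements, the truncated
      difference \<open>N - card U\<close> agrees with the real one.\<close>
    finally have "real (card {i\<in>{1..N}. s i \<le> s j}) \<le> 1 + real N - real (card U)"
      using card_mono [OF _ sub] by simp
    moreover have "\<alpha> * real N < real (card {i\<in>{1..N}. s i \<le> s j})"
      using j(1) assms(1) by (simp add: U_def rank_frac_def field_simps)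
    ultimately show ?thesis unfolding U_def [symmetric] by (simp add: algebra_simps)
  qed
qed

text \<open>The permutation maps the indices counted on the left bijectively onto those counted on
  the right.\<close>

lemma rank_frac_permute:
  assumes "\<pi> permutes {1..N}"
  shows "rank_frac N (s \<circ> \<pi>) j = rank_frac N s (\<pi> j)"
proof -
  have "{i\<in>{1..N}. s i \<le> s (\<pi> j)} = \<pi> ` {i\<in>{1..N}. s (\<pi> i) \<le> s (\<pi> j)}"
  proof (intro equalityI subsetI)
    fix i assume "i \<in> {i\<in>{1..N}. s i \<le> s (\<pi> j)}"
    then show "i \<in> \<pi> ` {i\<in>{1..N}. s (\<pi> i) \<le> s (\<pi> j)}"
      using permutes_in_image [OF permutes_inv [OF assms], of i] permutes_inverses(1) [OF assms, of i]
      by (intro image_eqI [of _ _ "inv \<pi> i"]) auto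
  qed (use permutes_in_image [OF assms] in auto)
  then have "card {i\<in>{1..N}. s i \<le> s (\<pi> j)} = card {i\<in>{1..N}. s (\<pi> i) \<le> s (\<pi> j)}"
    by (simp add: card_image inj_on_subset [OF permutes_inj [OF assms]])
  then show ?thesis by (simp add: rank_frac_def)
qed

lemma rank_frac_cong:
  assumes "\<And>i. i \<in> {1..N} \<Longrightarrow> s i = t i" "j \<in> {1..N}"
  shows "rank_frac N s j = rank_frac N t j"
proof -
  have "{i\<in>{1..N}. s i \<le> s j} = {i\<in>{1..N}. t i \<le> t j}" using assms by auto
  then show ?thesis by (simp add: rank_frac_def)
qed

text \<open>Let \<open>c\<close> count the indices of rank above \<alpha>. Its expectation is a sum
  of \<open>N\<close> equal probabilities, hence \<open>N * p\<close>, and the counting bounds on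
  \<open>c\<close> pass to the expectation. The upper one holds only where the scores are distinct,
  which almost surely suffices.\<close>

lemma (in prob_space) prob_rank_frac_bounds:
  fixes S :: "'a \<Rightarrow> nat \<Rightarrow> real"
  assumes "0 < N" "0 \<le> \<alpha>" "\<alpha> \<le> 1"
    and events: "\<And>j. j \<in> {1..N} \<Longrightarrow> {\<omega> \<in> space M. \<alpha> < rank_frac N (S \<omega>) j} \<in> events"
    and prob_eq: "\<And>j. j \<in> {1..N} \<Longrightarrow> prob {\<omega> \<in> space M. \<alpha> < rank_frac N (S \<omega>) j} = p"
  shows "1 - \<alpha> \<le> p"
    and "(AE \<omega> in M. inj_on (S \<omega>) {1..N}) \<Longrightarrow> p \<le> 1 - \<alpha> + 1 / real N"
proof -
  define B where "B j = {\<omega> \<in> space M. \<alpha> < rank_frac N (S \<omega>) j}" for j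
  define c where "c \<omega> = (\<Sum>j\<in>{1..N}. indicator (B j) \<omega> :: real)" for \<omega>
  have int: "integrable M (\<lambda>\<omega>. indicator (B j) \<omega> :: real)" if "j \<in> {1..N}" for j
    using events [OF that] by (intro integrable_real_indicator) (auto simp: B_def emeasure_eq_measure)
  have int_c: "integrable M c"
    unfolding c_def by (intro Bochner_Integration.integrable_sum int)
  have "expectation c = (\<Sum>j\<in>{1..N}. prob (B j))"
    unfolding c_def
    by (subst Bochner_Integration.integral_sum [OF int]) (auto simp: B_def Int_absorb2 intro!: sum.cong arg_cong [where f = prob])
  also have "\<dots> = real N * p" using prob_eq by (simp add: B_def)
  finally have exp_c: "expectation c = real N * p" .
  have c_card: "c \<omega> = real (card {j\<in>{1..N}. \<alpha> < rank_frac N (S \<omega>) j})" if "\<omega> \<in> space M" for \<omega>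
    using that by (simp add: c_def B_def indicator_def sum.If_cases Int_def)
  have "(1 - \<alpha>) * real N \<le> expectation c"
    by (intro integral_ge_const int_c AE_I2)
      (use card_rank_frac_gt_ge [OF assms(1,2)] c_card in auto)
  with exp_c assms(1) show "1 - \<alpha> \<le> p"
    by (metis mult.commute mult_le_cancel_right_pos of_nat_0_less_iff)
  assume "AE \<omega> in M. inj_on (S \<omega>) {1..N}"
  then have "AE \<omega> in M. c \<omega> \<le> (1 - \<alpha>) * real N + 1"
    using AE_space by eventually_elim (use card_rank_frac_gt_le [OF assms(1,3)] c_card in auto)
  then have "expectation c \<le> (1 - \<alpha>) * real N + 1"
    by (rule integral_le_const [OF int_c])
  with exp_c assms(1) show "p \<le> 1 - \<alpha> + 1 / real N"
    by (simp add: field_simps)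
qed

text \<open>
  The set \<open>Ys\<close> of responses need not be Borel, so events about data sets live in the trace
  \<open>\<sigma>\<close>-algebra on \<open>\<Omega>\<close> rather than in the product \<open>\<sigma>\<close>-algebra itself.
\<close>

lemma exchangeable_prob_eq:
  assumes exch: "exchangeable P N Z"
    and \<pi>: "\<pi> permutes {1..N}"
    and E: "E \<in> sets (restrict_space (Pi\<^sub>M {1..N} (\<lambda>_. borel)) \<Omega>)"
    and in_\<Omega>: "\<And>\<omega>. \<omega> \<in> space P \<Longrightarrow> (\<lambda>i\<in>{1..N}. Z i \<omega>) \<in> \<Omega>"
      "\<And>\<omega>. \<omega> \<in> space P \<Longrightarrow> (\<lambda>i\<in>{1..N}. Z (\<pi> i) \<omega>) \<in> \<Omega>"
  shows "{\<omega> \<in> space P. (\<lambda>i\<in>{1..N}. Z (\<pi> i) \<omega>) \<in> E} \<in> sets P"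
    and "measure P {\<omega> \<in> space P. (\<lambda>i\<in>{1..N}. Z (\<pi> i) \<omega>) \<in> E} =
      measure P {\<omega> \<in> space P. (\<lambda>i\<in>{1..N}. Z i \<omega>) \<in> E}"
proof -
  let ?M = "Pi\<^sub>M {1..N} (\<lambda>_. borel)"
  \<comment> \<open>Equality of distributions speaks only of sets of the product \<sigma>-algebra,
    so \<open>E\<close> is replaced by such a set \<open>E'\<close> with trace \<open>E\<close>.
    Both data vectors stay in \<Omega>, hence \<open>E\<close> and \<open>E'\<close> have the same
    preimages.\<close>
  obtain E' where E': "E' \<in> sets ?M" "E = \<Omega> \<inter> E'"
    using E by (auto simp: sets_restrict_space)
  have Z: "Z i \<in> measurable P borel" if "i \<in> {1..N}" for i
    using exch that unfolding exchangeable_def by blast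
  have meas: "(\<lambda>\<omega>. \<lambda>i\<in>{1..N}. Z i \<omega>) \<in> measurable P ?M"
    "(\<lambda>\<omega>. \<lambda>i\<in>{1..N}. Z (\<pi> i) \<omega>) \<in> measurable P ?M"
    by (rule measurable_restrict, rule Z, simp only: permutes_in_image [OF \<pi>])+
  have vimage: "{\<omega> \<in> space P. (\<lambda>i\<in>{1..N}. Z i \<omega>) \<in> E} = (\<lambda>\<omega>. \<lambda>i\<in>{1..N}. Z i \<omega>) -` E' \<inter> space P"
    "{\<omega> \<in> space P. (\<lambda>i\<in>{1..N}. Z (\<pi> i) \<omega>) \<in> E} = (\<lambda>\<omega>. \<lambda>i\<in>{1..N}. Z (\<pi> i) \<omega>) -` E' \<inter> space P"
    using in_\<Omega> unfolding E'(2) by blast+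
  show "{\<omega> \<in> space P. (\<lambda>i\<in>{1..N}. Z (\<pi> i) \<omega>) \<in> E} \<in> sets P"
    unfolding vimage using meas(2) E'(1) by (rule measurable_sets)
  have "distr P ?M (\<lambda>\<omega>. \<lambda>i\<in>{1..N}. Z (\<pi> i) \<omega>) = distr P ?M (\<lambda>\<omega>. \<lambda>i\<in>{1..N}. Z i \<omega>)"
    using exch \<pi> unfolding exchangeable_def by blast
  then show "measure P {\<omega> \<in> space P. (\<lambda>i\<in>{1..N}. Z (\<pi> i) \<omega>) \<in> E} =
      measure P {\<omega> \<in> space P. (\<lambda>i\<in>{1..N}. Z i \<omega>) \<in> E}"
    unfolding vimage measure_distr [OF meas(1) E'(1), symmetric]
      measure_distr [OF meas(2) E'(1), symmetric] by simp
qed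

section \<open>Conformity scores: relevant indices, permutations, measurability\<close>

lemma cbma_score_cong:
  fixes \<M> :: "nat \<Rightarrow> ('t, 'x) model"
  assumes "\<And>i. i \<in> {1..N} \<Longrightarrow> z i = z' i" "i \<in> {1..N}"
  shows "cbma_score N K \<M> w z i = cbma_score N K \<M> w z' i"
proof -
  have data: "data_lik N m z = data_lik N m z'" for m :: "('t, 'x) model"
    using assms(1) by (auto simp: data_lik_def fun_eq_iff)
  show ?thesis
    unfolding cbma_score_def cbma_measure_def model_posterior_def predictive_def posterior_def
      marginal_lik_def data assms(1) [OF assms(2)] ..
qed

text \<open>Invariance keeps the scored point fixed while the data are permuted. The point with
  index \<open>i\<close> in the permuted data is \<open>z (\<pi> i)\<close>, so the scores move
  along with the points.\<close>

lemma cbma_score_permute: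
  assumes "permutation_invariant N Ys (cbma_measure N K \<M> w)" "\<pi> permutes {1..N}"
    and "\<And>i. i \<in> {1..N} \<Longrightarrow> snd (z i) \<in> Ys" "i \<in> {1..N}"
  shows "cbma_score N K \<M> w (z \<circ> \<pi>) i = cbma_score N K \<M> w z (\<pi> i)"
  using assms permutes_in_image [OF assms(2), of i]
  by (simp add: cbma_score_def permutation_invariant_def)

text \<open>The score is built by sums, products, quotients and parameter integrals from functions
  that are jointly measurable in data and parameter. Responses carry the \<sigma>-algebra of \<nu>,
  because the likelihoods are measurable with respect to it.\<close>

lemma measurable_cbma_score:
  fixes \<M> :: "nat \<Rightarrow> ('t, 'x::topological_space) model"
  assumes models: "\<And>k. k \<in> {1..K} \<Longrightarrow> bayesian_model \<nu> (\<M> k)" and i: "i \<in> {1..N}"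
  shows "(\<lambda>z. cbma_score N K \<M> w z i) \<in> borel_measurable (Pi\<^sub>M {1..N} (\<lambda>_. borel \<Otimes>\<^sub>M \<nu>))"
proof -
  let ?D = "Pi\<^sub>M {1..N} (\<lambda>_. borel \<Otimes>\<^sub>M \<nu> :: ('x \<times> real) measure)"
  have lik: "(\<lambda>(z, \<theta>). lik (\<M> k) \<theta> (fst (z j)) (snd (z j))) \<in> borel_measurable (?D \<Otimes>\<^sub>M params (\<M> k))"
    if k: "k \<in> {1..K}" and j: "j \<in> {1..N}" for k j
  proof -
    have lik: "(\<lambda>(\<theta>, x, y). lik (\<M> k) \<theta> x y)
        \<in> borel_measurable (params (\<M> k) \<Otimes>\<^sub>M (borel \<Otimes>\<^sub>M \<nu>))"
      using models [OF k] by (simp add: bayesian_model_def)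
    have comp: "(\<lambda>z. z j) \<in> measurable ?D (borel \<Otimes>\<^sub>M \<nu>)"
      using j by (rule measurable_component_singleton)
    \<comment> \<open>\<open>bayesian_model\<close> lists the parameter first; here it comes second,
      so that it can be integrated out with the data as the remaining variable.\<close>
    have "(\<lambda>q. (snd q, fst q j))
        \<in> measurable (?D \<Otimes>\<^sub>M params (\<M> k)) (params (\<M> k) \<Otimes>\<^sub>M (borel \<Otimes>\<^sub>M \<nu>))"
      by (intro measurable_Pair measurable_snd measurable_compose [OF measurable_fst comp])
    from measurable_compose [OF this lik]
    have "(\<lambda>q. (\<lambda>(\<theta>, x, y). lik (\<M> k) \<theta> x y) (snd q, fst q j))
        \<in> borel_measurable (?D \<Otimes>\<^sub>M params (\<M> k))" .
    then show ?thesis unfolding case_prod_beta fst_conv snd_conv .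
  qed
  have prior: "(\<lambda>(z, \<theta>). prior (\<M> k) \<theta>) \<in> borel_measurable (?D \<Otimes>\<^sub>M params (\<M> k))"
    if k: "k \<in> {1..K}" for k
    unfolding case_prod_beta
    using models [OF k] unfolding bayesian_model_def
    by (intro measurable_compose [OF measurable_snd]) blast
  have data: "(\<lambda>(z, \<theta>). data_lik N (\<M> k) z \<theta>) \<in> borel_measurable (?D \<Otimes>\<^sub>M params (\<M> k))"
    if k: "k \<in> {1..K}" for k
    using lik [OF k] unfolding data_lik_def case_prod_beta by (rule borel_measurable_prod)
  \<comment> \<open>Sigma-finiteness of the parameter measure makes the partial integral measurable
    in the data.\<close>
  have integral: "(\<lambda>z. \<integral>\<theta>. f z \<theta> \<partial>params (\<M> k)) \<in> borel_measurable ?D"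
    if "k \<in> {1..K}" "(\<lambda>(z, \<theta>). f z \<theta>) \<in> borel_measurable (?D \<Otimes>\<^sub>M params (\<M> k))"
    for k and f :: "(nat \<Rightarrow> 'x \<times> real) \<Rightarrow> 't \<Rightarrow> real"
    using models [OF that(1)] that(2) unfolding bayesian_model_def
    by (intro sigma_finite_measure.borel_measurable_lebesgue_integral) blast+
  have marginal: "(\<lambda>z. marginal_lik N (\<M> k) z) \<in> borel_measurable ?D" if k: "k \<in> {1..K}" for k
    unfolding marginal_lik_def
    using data [OF k] prior [OF k] unfolding case_prod_beta
    by (intro integral [OF k, unfolded case_prod_beta] borel_measurable_times)
  have normalizer: "(\<lambda>z. \<integral>\<theta>. prior (\<M> k) \<theta> * data_lik N (\<M> k) z \<theta> \<partial>params (\<M> k))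
      \<in> borel_measurable ?D" if k: "k \<in> {1..K}" for k
    using data [OF k] prior [OF k] unfolding case_prod_beta
    by (intro integral [OF k, unfolded case_prod_beta] borel_measurable_times)
  have posterior: "(\<lambda>(z, \<theta>). posterior N (\<M> k) z \<theta>) \<in> borel_measurable (?D \<Otimes>\<^sub>M params (\<M> k))"
    if k: "k \<in> {1..K}" for k
    using data [OF k] prior [OF k] measurable_compose [OF measurable_fst normalizer [OF k]]
    unfolding posterior_def case_prod_beta
    by (intro borel_measurable_divide borel_measurable_times)
  have predictive: "(\<lambda>z. predictive N (\<M> k) z (fst (z i)) (snd (z i))) \<in> borel_measurable ?D"
    if k: "k \<in> {1..K}" for k
    using lik [OF k i] posterior [OF k] unfolding predictive_def case_prod_beta
    by (intro integral [OF k, unfolded case_prod_beta] borel_measurable_times)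
  show ?thesis
    unfolding cbma_score_def cbma_measure_def model_posterior_def
    by (intro borel_measurable_sum borel_measurable_times borel_measurable_divide
        borel_measurable_const marginal predictive)
qed

text \<open>Connects two \<sigma>-algebras on data sets: exchangeability is stated for the Borel
  sets of pairs, measurability of the scores for the product with \<nu>. They are compatible once
  all responses lie in \<open>Ys\<close>.\<close>

lemma measurable_restrict_PiM_id:
  fixes \<nu> :: "real measure"
  assumes "space \<nu> = Ys" "sets \<nu> = sets (restrict_space borel Ys)"
  shows "(\<lambda>z. z) \<in> measurable
      (restrict_space (Pi\<^sub>M {1..N} (\<lambda>_. borel)) (Pi\<^sub>E {1..N} (\<lambda>_. UNIV \<times> Ys)))
      (Pi\<^sub>M {1..N} (\<lambda>_. borel \<Otimes>\<^sub>M \<nu> :: ('x::second_countable_topology \<times> real) measure))"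
    (is "_ \<in> measurable ?R _")
proof (rule measurable_PiM_single')
  fix i assume i: "i \<in> {1..N}"
  have zi: "(\<lambda>z. z i) \<in> measurable ?R (borel :: ('x \<times> real) measure)"
    using i by (intro measurable_restrict_space1 measurable_component_singleton)
  \<comment> \<open>Second countability lets \<open>borel_prod\<close> split the Borel
    \<sigma>-algebra of pairs into a product.\<close>
  have "(\<lambda>z. fst (z i)) \<in> measurable ?R (borel :: 'x measure)"
    "(\<lambda>z. snd (z i)) \<in> measurable ?R borel"
    using zi by (simp_all add: borel_prod [symmetric])
  moreover from this(2) have "(\<lambda>z. snd (z i)) \<in> measurable ?R (restrict_space borel Ys)"
    using i by (intro measurable_restrict_space2) (auto simp: space_restrict_space dest!: PiE_mem)
  then have "(\<lambda>z. snd (z i)) \<in> measurable ?R \<nu>"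
    using measurable_cong_sets [OF refl assms(2)] by blast
  ultimately have "(\<lambda>z. (fst (z i), snd (z i))) \<in> measurable ?R (borel \<Otimes>\<^sub>M \<nu>)"
    by (intro measurable_Pair)
  then show "(\<lambda>z. z i) \<in> measurable ?R (borel \<Otimes>\<^sub>M \<nu>)" by simp
next
  show "(\<lambda>z. z) \<in> space ?R \<rightarrow> Pi\<^sub>E {1..N} (\<lambda>_. space (borel \<Otimes>\<^sub>M \<nu>))"
    using assms(1) by (auto simp: space_restrict_space space_pair_measure)
qed

lemma measurable_rank_frac:
  assumes "\<And>i. i \<in> {1..N} \<Longrightarrow> (\<lambda>z. s z i) \<in> borel_measurable M" "j \<in> {1..N}"
  shows "(\<lambda>z. rank_frac N (s z) j) \<in> borel_measurable M"
proof -
  have "rank_frac N (s z) j = (\<Sum>i\<in>{1..N}. if s z i \<le> s z j then 1 else 0) / real N" for z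
    by (simp add: rank_frac_def sum.If_cases Int_def)
  moreover have "(\<lambda>z. (\<Sum>i\<in>{1..N}. if s z i \<le> s z j then 1 else 0) / real N :: real)
      \<in> borel_measurable M"
    using assms by (intro borel_measurable_divide borel_measurable_sum measurable_If) auto
  ultimately show ?thesis by simp
qed

text \<open>At the actual last point, overwriting the data with the candidate changes
  nothing.\<close>

lemma cbma_rank_eq_rank_frac:
  "cbma_rank n K \<M> w z (fst (z (n + 1))) (snd (z (n + 1))) =
    rank_frac (n + 1) (cbma_score (n + 1) K \<M> w z) (n + 1)"
  by (simp add: cbma_rank_def rank_frac_def Let_def of_bool_def sum.If_cases Int_def
      del: sum.cl_ivl_Suc)

section \<open>Coverage of the CBMA prediction set\<close>

theorem theorem1:
  fixes P :: "'w measure"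
    and X :: "nat \<Rightarrow> 'w \<Rightarrow> real ^ 'd"
    and Y :: "nat \<Rightarrow> 'w \<Rightarrow> real"
    and Ys :: "real set"
    and \<nu> :: "real measure"
    and \<M> :: "nat \<Rightarrow> ('t, real ^ 'd) model"
    and w :: "nat \<Rightarrow> real"
    and \<alpha> :: real
    and n K :: nat
  defines "Z \<equiv> \<lambda>\<omega> i. (X i \<omega>, Y i \<omega>)"
  assumes "0 < \<alpha>" and "\<alpha> < 1"
    and "prob_space P"
    and "exchangeable P (n + 1) (\<lambda>i \<omega>. Z \<omega> i)"
    and "\<And>i \<omega>. i \<in> {1..n + 1} \<Longrightarrow> \<omega> \<in> space P \<Longrightarrow> Y i \<omega> \<in> Ys"
    and "space \<nu> = Ys" and "sets \<nu> = sets (restrict_space borel Ys)"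
    and "\<And>k. k \<in> {1..K} \<Longrightarrow> bayesian_model \<nu> (\<M> k)"
    and "\<And>k. k \<in> {1..K} \<Longrightarrow> 0 \<le> w k" and "(\<Sum>k\<in>{1..K}. w k) = 1"
    and "AE \<omega> in P. \<forall>y\<in>Ys.
           cbma_well_defined (n + 1) K \<M> ((Z \<omega>)(n + 1 := (X (n + 1) \<omega>, y)))"
    and "permutation_invariant (n + 1) Ys (cbma_measure (n + 1) K \<M> w)"
  shows "measure P {\<omega> \<in> space P. Y (n + 1) \<omega> \<in> cbma_set Ys \<alpha> n K \<M> w (Z \<omega>) (X (n + 1) \<omega>)}
           \<ge> 1 - \<alpha> \<and>
         ((AE \<omega> in P. inj_on (cbma_score (n + 1) K \<M> w (Z \<omega>)) {1..n + 1}) \<longrightarrow>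
          measure P {\<omega> \<in> space P. Y (n + 1) \<omega> \<in> cbma_set Ys \<alpha> n K \<M> w (Z \<omega>) (X (n + 1) \<omega>)}
           \<le> 1 - \<alpha> + 1 / real (n + 1))"
proof -
  interpret prob_space P by fact
  note exch = assms(5) and in_Ys = assms(6) and \<nu> = assms(7,8) and models = assms(9)
    and inv = assms(13)
  let ?N = "n + 1"
  let ?R = "restrict_space (Pi\<^sub>M {1..?N} (\<lambda>_. borel :: ((real ^ 'd) \<times> real) measure))
    (Pi\<^sub>E {1..?N} (\<lambda>_. UNIV \<times> Ys))"
  define s where "s = cbma_score ?N K \<M> w"
  \<comment> \<open>Coverage is expressed as a set of data vectors, so that exchangeability can be
    applied to it.\<close>
  define E where "E = {z \<in> space ?R. \<alpha> < rank_frac ?N (s z) ?N}"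
  have "(\<lambda>z. s z i) \<in> borel_measurable ?R" if "i \<in> {1..?N}" for i
    unfolding s_def using measurable_restrict_PiM_id [OF \<nu>] measurable_cbma_score [OF models that]
    by (rule measurable_compose)
  then have "(\<lambda>z. rank_frac ?N (s z) ?N) \<in> borel_measurable ?R"
    by (intro measurable_rank_frac) auto
  then have E: "E \<in> sets ?R"
    unfolding E_def by simp
  \<comment> \<open>The last entry of the permuted data is the original point
    \<open>\<pi> ?N\<close>, and it keeps its rank.\<close>
  have E_iff: "(\<lambda>i\<in>{1..?N}. Z \<omega> (\<pi> i)) \<in> E \<longleftrightarrow> \<alpha> < rank_frac ?N (s (Z \<omega>)) (\<pi> ?N)"
    and in_PiE: "(\<lambda>i\<in>{1..?N}. Z \<omega> (\<pi> i)) \<in> Pi\<^sub>E {1..?N} (\<lambda>_. UNIV \<times> Ys)"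
    if \<omega>: "\<omega> \<in> space P" and \<pi>: "\<pi> permutes {1..?N}" for \<omega> \<pi>
  proof -
    show mem: "(\<lambda>i\<in>{1..?N}. Z \<omega> (\<pi> i)) \<in> Pi\<^sub>E {1..?N} (\<lambda>_. UNIV \<times> Ys)"
      using in_Ys [OF _ \<omega>] permutes_in_image [OF \<pi>] by (auto simp: Z_def)
    have "s (\<lambda>i\<in>{1..?N}. Z \<omega> (\<pi> i)) i = (s (Z \<omega>) \<circ> \<pi>) i" if i: "i \<in> {1..?N}" for i
    proof -
      \<comment> \<open>The restricted vector is \<open>undefined\<close> outside the index range,
        but scores read the data only inside it.\<close>
      have "s (\<lambda>i\<in>{1..?N}. Z \<omega> (\<pi> i)) i = s (Z \<omega> \<circ> \<pi>) i"
        unfolding s_def using i by (intro cbma_score_cong) auto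
      also have "\<dots> = s (Z \<omega>) (\<pi> i)"
        unfolding s_def using in_Ys [OF _ \<omega>] i
        by (intro cbma_score_permute [OF inv \<pi>]) (auto simp: Z_def)
      finally show ?thesis by simp
    qed
    then have "rank_frac ?N (s (\<lambda>i\<in>{1..?N}. Z \<omega> (\<pi> i))) ?N = rank_frac ?N (s (Z \<omega>)) (\<pi> ?N)"
      by (subst rank_frac_permute [OF \<pi>, symmetric]) (intro rank_frac_cong, auto)
    then show "(\<lambda>i\<in>{1..?N}. Z \<omega> (\<pi> i)) \<in> E \<longleftrightarrow> \<alpha> < rank_frac ?N (s (Z \<omega>)) (\<pi> ?N)"
      using mem by (simp add: E_def space_restrict_space space_PiM)
  qed
  define B where "B j = {\<omega> \<in> space P. \<alpha> < rank_frac ?N (s (Z \<omega>)) j}" for j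
  have B: "B j \<in> events" "prob (B j) = prob (B ?N)" if j: "j \<in> {1..?N}" for j
  proof -
    \<comment> \<open>Swapping \<open>j\<close> with the last index turns the event for
      \<open>j\<close> into membership of the permuted data in \<open>E\<close>.\<close>
    define \<pi> where "\<pi> = Transposition.transpose j ?N"
    have \<pi>: "\<pi> permutes {1..?N}"
      unfolding \<pi>_def using j by (intro permutes_swap_id) auto
    have Bj: "B j = {\<omega> \<in> space P. (\<lambda>i\<in>{1..?N}. Z \<omega> (\<pi> i)) \<in> E}"
      unfolding B_def using E_iff [OF _ \<pi>] by (auto simp: \<pi>_def)
    have BN: "B ?N = {\<omega> \<in> space P. (\<lambda>i\<in>{1..?N}. Z \<omega> i) \<in> E}"
      unfolding B_def using E_iff [OF _ permutes_id] by auto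
    note exchangeable_prob_eq [OF exch \<pi> E in_PiE [OF _ permutes_id, simplified id_apply] in_PiE [OF _ \<pi>]]
    then show "B j \<in> events" "prob (B j) = prob (B ?N)"
      unfolding Bj BN by simp_all
  qed
  have "Y ?N \<omega> \<in> cbma_set Ys \<alpha> n K \<M> w (Z \<omega>) (X ?N \<omega>) \<longleftrightarrow> \<alpha> < rank_frac ?N (s (Z \<omega>)) ?N"
    if "\<omega> \<in> space P" for \<omega>
    using in_Ys [OF _ that, of ?N] cbma_rank_eq_rank_frac [of n K \<M> w "Z \<omega>"]
    by (simp add: cbma_set_def s_def Z_def)
  then have "{\<omega> \<in> space P. Y ?N \<omega> \<in> cbma_set Ys \<alpha> n K \<M> w (Z \<omega>) (X ?N \<omega>)} = B ?N"
    by (auto simp: B_def)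
  \<comment> \<open>The common probability \<open>p\<close> becomes \<open>prob (B ?N)\<close>, the
    coverage probability.\<close>
  moreover note prob_rank_frac_bounds [of ?N \<alpha> "\<lambda>\<omega>. s (Z \<omega>)", folded B_def, OF _ _ _ B]
  ultimately show ?thesis
    using assms(2,3) by (simp add: s_def)
qed

end
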